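(* Let $f(z)$ be an analytic function on an open set $\Omega\subset\mathbb{C}$ and let $z_1,z_2\in\Omega$ with $z_1\neq z_2$. Then $f(z)$ admits the two-point Taylor expansion $$f(z)=\sum_{n=0}^{N-1}\left[a_n(z_1,z_2)(z-z_1)+a_n(z_2,z_1)(z-z_2)\right](z-z_1)^n(z-z_2)^n+r_N(z_1,z_2;z),$$ where the coefficients $a_n(z_1,z_2)$ and $a_n(z_2,z_1)$ are given by the Cauchy integral $$a_n(z_1,z_2)=\frac{1}{2\pi i(z_2-z_1)}\int_{\mathcal C}\frac{f(w)\,dw}{(w-z_1)^n(w-z_2)^{n+1}}$$ (with $z_1$ and $z_2$ interchanged for $a_n(z_2,z_1)$), and the remainder term $r_N(z_1,z_2;z)$ is given by the Cauchy integral $$r_N(z_1,z_2;z)=\frac{1}{2\pi i}\int_{\mathcal C}\frac{f(w)\,dw}{(w-z_1)^N(w-z_2)^N(w-z)}\,(z-z_1)^N(z-z_2)^N.$$ The contour of integration $\mathcal C$ is a simple closed loop which encircles the points $z_1$ and $z_2$ (for $a_n$) and $z$, $z_1$ and $z_2$ (for $r_N$) in the counterclockwise direction and is contained in $\Omega$. The expansion is convergent for $z$ inside the Cassini oval $$O_{z_1,z_2}=\{z\in\Omega:\ |(z-z_1)(z-z_2)|<r\},\qquad r=\inf_{w\in\mathbb{C}\setminus\Omega}|(w-z_1)(w-z_2)|.$$ In particular, if $f(z)$ is an entire function ($\Omega=\mathbb{C}$), then the expansion converges for all $z\in\mathbb{C}$.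
   Context: $N$ is a positive integer. Convergence of the expansion means that $r_N(z_1,z_2;z)\to0$ as $N\to\infty$. The infimum of the empty set is $+\infty$.
   Formalization: The loop C is required to lie in Ω together with its interior; a loop in Ω around a hole makes the formulas false (f(w)=1/w, Ω=ℂ∖{0}). They hold for every such loop; if none exists, suitable coefficients and remainders are still shown to exist. *)

theory Defs
  imports "HOL-Complex_Analysis.Complex_Analysis"
begin

(* For a simple closed path the winding number about any inside point is 1 or -1, and the value 1
   expresses the counterclockwise orientation. The loop bounds a region on which the integrated
   function has to be analytic, so its interior is required to lie in \<Omega> too: if \<Omega> has holes,
   the Cauchy formulas fail for a loop that lies in \<Omega> but goes around a hole. *)
definition ccw_loop_around :: "complex set \<Rightarrow> complex set \<Rightarrow> (real \<Rightarrow> complex) \<Rightarrow> bool" where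
  "ccw_loop_around \<Omega> S C \<longleftrightarrow>
     valid_path C \<and> simple_path C \<and> pathfinish C = pathstart C \<and>
     path_image C \<subseteq> \<Omega> \<and> inside (path_image C) \<subseteq> \<Omega> \<and>
     S \<subseteq> inside (path_image C) \<and> (\<forall>s\<in>S. winding_number C s = 1)"

definition tp_coeff :: "(complex \<Rightarrow> complex) \<Rightarrow> (real \<Rightarrow> complex) \<Rightarrow> nat \<Rightarrow> complex \<Rightarrow> complex \<Rightarrow> complex" where
  "tp_coeff f C n z1 z2 =
     1 / (2 * of_real pi * \<i> * (z2 - z1)) *
     contour_integral C (\<lambda>w. f w / ((w - z1) ^ n * (w - z2) ^ (n + 1)))"

definition tp_remainder ::
  "(complex \<Rightarrow> complex) \<Rightarrow> (real \<Rightarrow> complex) \<Rightarrow> nat \<Rightarrow> complex \<Rightarrow> complex \<Rightarrow> complex \<Rightarrow> complex" where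
  "tp_remainder f C N z1 z2 z =
     1 / (2 * of_real pi * \<i>) *
     contour_integral C (\<lambda>w. f w / ((w - z1) ^ N * (w - z2) ^ N * (w - z))) *
     (z - z1) ^ N * (z - z2) ^ N"

(* Extended reals, so that the radius is \<infinity> for \<Omega> = UNIV. *)
definition cassini_radius :: "complex set \<Rightarrow> complex \<Rightarrow> complex \<Rightarrow> ereal" where
  "cassini_radius \<Omega> z1 z2 = (INF w\<in>- \<Omega>. ereal (cmod ((w - z1) * (w - z2))))"

definition cassini_oval :: "complex set \<Rightarrow> complex \<Rightarrow> complex \<Rightarrow> complex set" where
  "cassini_oval \<Omega> z1 z2 =
     {z \<in> \<Omega>. ereal (cmod ((z - z1) * (z - z2))) < cassini_radius \<Omega> z1 z2}"

end

theory Submission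
  imports Defs
begin

text \<open>
  Write \<open>p w = (w - z1) * (w - z2)\<close>. Subtracting from \<open>f\<close> its linear interpolant at \<open>z1\<close> and
  \<open>z2\<close> and dividing by \<open>p\<close> gives a function that is again holomorphic on \<open>\<Omega>\<close>, because both
  singularities are removable. Iterating this quotient \<open>N\<close> times expands \<open>f\<close> as a sum of linear
  functions times \<open>p ^ n\<close> plus \<open>p ^ N\<close> times the \<open>N\<close>-th quotient
  (\<open>node_quotient_funpow_expand\<close>). This defines the coefficients and the remainder without any
  contour, so that they make sense even if \<open>z1\<close> and \<open>z2\<close> lie in different components of \<open>\<Omega>\<close>
  and no loop in \<open>\<Omega>\<close> surrounds both.

  Both Cauchy integral formulas say that the \<open>n\<close>-th quotient at \<open>\<zeta>\<close> is the Cauchy integral of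
  \<open>f w / (p w ^ n * (w - \<zeta>))\<close>, with \<open>\<zeta>\<close> a node for the coefficients and \<open>\<zeta> = z\<close> for the
  remainder (\<open>has_contour_integral_node_quotient_funpow\<close>). One step of the quotient changes the
  integrand only by rational functions that have all their poles inside the loop and decay at least
  like \<open>1 / w\<^sup>2\<close> at infinity, and their integrals vanish
  (\<open>has_contour_integral_inverse_prod_mset\<close>); for \<open>n = 0\<close> it is Cauchy's formula.

  Convergence in the Cassini oval reduces to ordinary Taylor series. Put \<open>c = (z1 + z2) / 2\<close>.
  Since \<open>p\<close> is a function of \<open>(w - c)\<^sup>2\<close>, separating \<open>f\<close> into its even and odd parts about \<open>c\<close>
  gives \<open>f w = g (p w) + (w - c) * h (p w)\<close>, with \<open>g\<close> and \<open>h\<close> holomorphic on a disc about \<open>0\<close>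
  (\<open>cassini_decomposition\<close>). Under this decomposition the two-point quotient of \<open>f\<close> corresponds to
  the quotients \<open>(g u - g 0) / u\<close> and \<open>(h u - h 0) / u\<close>, which shift Taylor coefficients. The
  two-point expansion of \<open>f\<close> is therefore the combination of the Taylor series of \<open>g\<close> and \<open>h\<close>
  evaluated at \<open>p w\<close>, and it converges wherever these do.
\<close>

section \<open>Divided differences at one and at two nodes\<close>

definition divdiff :: "(complex \<Rightarrow> complex) \<Rightarrow> complex \<Rightarrow> complex \<Rightarrow> complex" where
  "divdiff f a z = (if z = a then deriv f a else (f z - f a) / (z - a))"

text \<open>
  Two successive divided differences give, for distinct nodes, the function
  \<open>(f - L) / ((z - z1) * (z - z2))\<close>, where \<open>L\<close> is the linear interpolant of \<open>f\<close> at the nodes.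
  In this form its removable singularities are filled in one at a time.
\<close>
definition node_quotient ::
  "complex \<Rightarrow> complex \<Rightarrow> (complex \<Rightarrow> complex) \<Rightarrow> complex \<Rightarrow> complex" where
  "node_quotient z1 z2 f = divdiff (divdiff f z1) z2"

lemma holomorphic_divdiff:
  assumes "f holomorphic_on S" "open S"
  shows "divdiff f a holomorphic_on S"
  using pole_lemma_open[OF assms, of a] unfolding divdiff_def[abs_def] .

lemma holomorphic_node_quotient_funpow:
  assumes "f holomorphic_on S" "open S"
  shows "(node_quotient z1 z2 ^^ n) f holomorphic_on S"
  by (induction n) (simp_all add: assms holomorphic_divdiff node_quotient_def)

lemma divdiff_expand: "f z = f a + (z - a) * divdiff f a z"
  by (simp add: divdiff_def)

text \<open>
  Newton's form of interpolation at two nodes, with the linear part rewritten in Lagrange's form.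
\<close>
lemma node_quotient_expand:
  assumes "z1 \<noteq> z2"
  shows "f z = f z2 / (z2 - z1) * (z - z1) + f z1 / (z1 - z2) * (z - z2)
           + (z - z1) * (z - z2) * node_quotient z1 z2 f z"
proof -
  have "f z = f z1 + (z - z1) * divdiff f z1 z"
    by (rule divdiff_expand)
  also have "divdiff f z1 z = divdiff f z1 z2 + (z - z2) * node_quotient z1 z2 f z"
    unfolding node_quotient_def by (rule divdiff_expand)
  also have "divdiff f z1 z2 = (f z2 - f z1) / (z2 - z1)"
    using assms by (simp add: divdiff_def)
  also have "f z1 + (z - z1) * ((f z2 - f z1) / (z2 - z1) + (z - z2) * node_quotient z1 z2 f z)
      = f z1 * (1 - (z - z1) / (z2 - z1)) + f z2 / (z2 - z1) * (z - z1)
        + (z - z1) * (z - z2) * node_quotient z1 z2 f z"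
    by (simp add: algebra_simps diff_divide_distrib)
  also have "1 - (z - z1) / (z2 - z1) = (z - z2) / (z1 - z2)"
    using assms by (simp add: divide_simps) (simp add: algebra_simps)
  finally show ?thesis
    by (simp add: algebra_simps)
qed

lemma node_quotient_funpow_expand:
  assumes "z1 \<noteq> z2"
  shows "f z = (\<Sum>n<N. ((node_quotient z1 z2 ^^ n) f z2 / (z2 - z1) * (z - z1)
                    + (node_quotient z1 z2 ^^ n) f z1 / (z1 - z2) * (z - z2))
                  * (z - z1) ^ n * (z - z2) ^ n)
           + (z - z1) ^ N * (z - z2) ^ N * (node_quotient z1 z2 ^^ N) f z"
proof (induction N)
  case (Suc N)
  let ?F = "(node_quotient z1 z2 ^^ N) f"
  have "?F z = ?F z2 / (z2 - z1) * (z - z1) + ?F z1 / (z1 - z2) * (z - z2)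
          + (z - z1) * (z - z2) * node_quotient z1 z2 ?F z"
    by (rule node_quotient_expand[OF assms])
  then have "(z - z1) ^ N * (z - z2) ^ N * ?F z
      = (?F z2 / (z2 - z1) * (z - z1) + ?F z1 / (z1 - z2) * (z - z2)) * (z - z1) ^ N * (z - z2) ^ N
          + (z - z1) ^ Suc N * (z - z2) ^ Suc N * node_quotient z1 z2 ?F z"
    by (simp only: distrib_left power_Suc mult_ac)
  with Suc.IH show ?case
    by (simp only: sum.lessThan_Suc funpow.simps o_apply add.assoc)
qed simp

section \<open>Cauchy integrals along a loop around the nodes\<close>

text \<open>
  Such a rational function decays like \<open>w\<close> to the power \<open>- size M\<close>, so from size \<open>2\<close> on its residue
  at infinity vanishes and the residues at the finite poles, all weighted by the same winding number,
  cancel. The proof replaces the residue at infinity by partial fractions: two different poles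
  \<open>s\<close>, \<open>t\<close> are separated by \<open>1 / ((w - s) * (w - t)) = (1 / (w - s) - 1 / (w - t)) / (s - t)\<close>. Both
  terms belong to multisets of the same smaller size, hence have the same integral. Including
  size \<open>1\<close> in the claim makes this argument uniform.
\<close>
lemma has_contour_integral_inverse_prod_mset:
  assumes "valid_path \<gamma>" "pathfinish \<gamma> = pathstart \<gamma>" "M \<noteq> {#}"
    and "\<And>s. s \<in># M \<Longrightarrow> s \<notin> path_image \<gamma>"
    and "\<And>s. s \<in># M \<Longrightarrow> winding_number \<gamma> s = k"
  shows "((\<lambda>w. 1 / (\<Prod>s\<in>#M. w - s)) has_contour_integral
           (if size M = 1 then 2 * of_real pi * \<i> * k else 0)) \<gamma>"
  using assms(3-5)
proof (induction "size M" arbitrary: M rule: less_induct)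
  case less
  from less.prems(1) obtain s L where M: "M = add_mset s L"
    by (meson multiset_cases)
  show ?case
  proof (cases "set_mset L \<subseteq> {s}")
    case True
    define m where "m = size L"
    have L: "L = replicate_mset m s"
      using True unfolding m_def by (simp add: set_mset_subset_singletonD)
    show ?thesis
    proof (cases m)
      case 0
      then show ?thesis
        using has_contour_integral_winding_number[of \<gamma> s] assms(1) less.prems(2,3)
        by (simp add: M L)
    next
      case (Suc j)
      have "((\<lambda>w. 1 / (w - s) ^ Suc (Suc j)) has_contour_integral 0) \<gamma>"
      proof (rule Cauchy_theorem_primitive[where S = "- {s}"])
        fix x assume "x \<in> - {s}"
        then have "x - s \<noteq> 0" by simp
        then have "((\<lambda>w. - (1 / of_nat (Suc j)) * inverse (w - s) ^ Suc j) has_field_derivative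
               1 / (x - s) ^ Suc (Suc j)) (at x)"
          by (auto intro!: derivative_eq_intros simp del: of_nat_Suc simp: divide_simps)
             (cases j; simp add: algebra_simps)
        then show "((\<lambda>w. - (1 / of_nat (Suc j)) * inverse (w - s) ^ Suc j) has_field_derivative
               1 / (x - s) ^ Suc (Suc j)) (at x within - {s})"
          by (rule has_field_derivative_at_within)
      qed (use assms(1,2) less.prems(2) M in auto)
      then show ?thesis
        by (simp add: M L Suc)
    qed
  next
    case False
    then obtain t where t: "t \<in># L" "t \<noteq> s" by auto
    then obtain K where L: "L = add_mset t K"
      by (meson mset_add)
    let ?f = "\<lambda>w. (1 / (\<Prod>x\<in>#add_mset s K. w - x) - 1 / (\<Prod>x\<in>#add_mset t K. w - x)) / (s - t)"
    have *: "((\<lambda>w. 1 / (\<Prod>x\<in>#add_mset s K. w - x)) has_contour_integral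
           (if size (add_mset s K) = 1 then 2 * of_real pi * \<i> * k else 0)) \<gamma>"
      by (rule less.hyps) (use less.prems in \<open>auto simp: M L\<close>)
    have **: "((\<lambda>w. 1 / (\<Prod>x\<in>#add_mset t K. w - x)) has_contour_integral
           (if size (add_mset t K) = 1 then 2 * of_real pi * \<i> * k else 0)) \<gamma>"
      by (rule less.hyps) (use less.prems in \<open>auto simp: M L\<close>)
    have int: "(?f has_contour_integral 0) \<gamma>"
      using has_contour_integral_div[OF has_contour_integral_diff[OF * **], of "s - t"] by simp
    have eq: "?f w = 1 / (\<Prod>x\<in>#M. w - x)" if "w \<in> path_image \<gamma>" for w
    proof -
      have "w \<noteq> s" "w \<noteq> t" "(\<Prod>x\<in>#K. w - x) \<noteq> 0"
        using that less.prems(2) by (auto simp: M L)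
      then show ?thesis
        using t(2) by (simp add: M L divide_simps)
    qed
    show ?thesis
      using has_contour_integral_eq[OF int eq] by (simp add: M L)
  qed
qed

lemma winding_number_ccw_loop_off_domain:
  assumes "ccw_loop_around \<Omega> S C" "w \<notin> \<Omega>"
  shows "winding_number C w = 0"
proof -
  have "w \<in> outside (path_image C)"
    using assms union_with_inside[of "path_image C"] unfolding ccw_loop_around_def
    by (auto simp: outside_inside)
  then show ?thesis
    using assms(1) by (auto simp: ccw_loop_around_def intro: winding_number_zero_in_outside valid_path_imp_path)
qed

text \<open>
  The induction moves one power of \<open>(w - z1) * (w - z2)\<close> from the denominator into the quotient.
  The point \<open>\<zeta>\<close> may coincide with a node; this is the case that yields the coefficients.
\<close>
lemma has_contour_integral_node_quotient_funpow:
  assumes "open \<Omega>" and "f holomorphic_on \<Omega>" and "z1 \<noteq> z2"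
    and C: "ccw_loop_around \<Omega> S C" and S: "z1 \<in> S" "z2 \<in> S" "\<zeta> \<in> S"
  shows "((\<lambda>w. f w / (((w - z1) * (w - z2)) ^ n * (w - \<zeta>))) has_contour_integral
           2 * of_real pi * \<i> * (node_quotient z1 z2 ^^ n) f \<zeta>) C"
proof -
  have vp: "valid_path C" and lp: "pathfinish C = pathstart C"
    using C by (auto simp: ccw_loop_around_def)
  have off: "s \<notin> path_image C" "winding_number C s = 1" if "s \<in> S" for s
    using C that inside_no_overlap[of "path_image C"] unfolding ccw_loop_around_def by blast+
  from assms(2) show ?thesis
  proof (induction n arbitrary: f)
    case 0
    have "((\<lambda>w. f w / (w - \<zeta>)) has_contour_integral
             2 * pi * \<i> * winding_number C \<zeta> * f \<zeta>) C"
    proof (rule Cauchy_integral_formula_global[OF assms(1) 0 _ vp _ lp])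
      show "winding_number C w = 0" if "w \<notin> \<Omega>" for w
        using winding_number_ccw_loop_off_domain[OF C that] .
    qed (use C S off in \<open>auto simp: ccw_loop_around_def\<close>)
    then show ?case
      using off S by simp
  next
    case (Suc n)
    define Q where "Q = node_quotient z1 z2 f"
    have "Q holomorphic_on \<Omega>"
      using holomorphic_node_quotient_funpow[OF Suc.prems assms(1), where n = 1] by (simp add: Q_def)
    note IH = Suc.IH[OF this]
    have vanish: "((\<lambda>w. 1 / ((w - s) * (w - \<zeta>) * ((w - z1) * (w - z2)) ^ n))
                     has_contour_integral 0) C" if "s \<in> S" for s
    proof -
      let ?M = "{#s, \<zeta>#} + replicate_mset n z1 + replicate_mset n z2"
      have "((\<lambda>w. 1 / (\<Prod>x\<in>#?M. w - x)) has_contour_integral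
           (if size ?M = 1 then 2 * of_real pi * \<i> * 1 else 0)) C"
        by (rule has_contour_integral_inverse_prod_mset[OF vp lp]) (use off S that in \<open>auto split: if_splits\<close>)
      then show ?thesis
        by (simp add: power_mult_distrib mult_ac)
    qed
    \<comment> \<open>The integrand, after \<^term>\<open>f\<close> is replaced by its linear interpolant plus the quotient term.\<close>
    let ?g = "\<lambda>w. f z2 / (z2 - z1) * (1 / ((w - z2) * (w - \<zeta>) * ((w - z1) * (w - z2)) ^ n))
                + f z1 / (z1 - z2) * (1 / ((w - z1) * (w - \<zeta>) * ((w - z1) * (w - z2)) ^ n))
                + Q w / (((w - z1) * (w - z2)) ^ n * (w - \<zeta>))"
    have int: "(?g has_contour_integral
        (f z2 / (z2 - z1) * 0 + f z1 / (z1 - z2) * 0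
           + 2 * of_real pi * \<i> * (node_quotient z1 z2 ^^ n) Q \<zeta>)) C"
      by (intro has_contour_integral_add has_contour_integral_lmul vanish S IH)
    have eq: "?g w = f w / (((w - z1) * (w - z2)) ^ Suc n * (w - \<zeta>))"
      if "w \<in> path_image C" for w
    proof -
      have nz: "w - z1 \<noteq> 0" "w - z2 \<noteq> 0" "w - \<zeta> \<noteq> 0"
        using that off S by auto
      define P where "P = ((w - z1) * (w - z2)) ^ n"
      have "P \<noteq> 0" using nz by (simp add: P_def)
      define \<alpha> \<beta> where "\<alpha> = f z2 / (z2 - z1)" and "\<beta> = f z1 / (z1 - z2)"
      have "f w = \<alpha> * (w - z1) + \<beta> * (w - z2) + (w - z1) * (w - z2) * Q w"
        unfolding \<alpha>_def \<beta>_def Q_def by (rule node_quotient_expand[OF assms(3)])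
      moreover have "\<alpha> * (1 / ((w - z2) * (w - \<zeta>) * P)) + \<beta> * (1 / ((w - z1) * (w - \<zeta>) * P))
            + Q w / (P * (w - \<zeta>))
          = (\<alpha> * (w - z1) + \<beta> * (w - z2) + (w - z1) * (w - z2) * Q w)
              / ((w - z1) * (w - z2) * P * (w - \<zeta>))"
        using nz \<open>P \<noteq> 0\<close> by (simp add: divide_simps)
      ultimately show ?thesis
        unfolding \<alpha>_def[symmetric] \<beta>_def[symmetric] P_def[symmetric] power_Suc
        by simp
    qed
    show ?case
      using has_contour_integral_eq[OF int eq]
      by (simp only: Q_def funpow_Suc_right o_apply mult_zero_right add_0)
  qed
qed

section \<open>Analytic functions in a Cassini oval\<close>

text \<open>
  An even holomorphic function of \<open>t\<close> is a holomorphic function of \<open>t\<^sup>2\<close>. Off the branch cut of the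
  square root this is a composition. On the negative axis \<open>\<i> * csqrt (- v)\<close> is a holomorphic
  branch, and evenness makes the choice of branch irrelevant. The branch point \<open>0\<close> is a
  removable singularity, since the square root is continuous there.
\<close>
lemma holomorphic_on_even_csqrt:
  assumes "open V" and E: "E holomorphic_on {t. t\<^sup>2 \<in> V}"
    and even: "\<And>t. t\<^sup>2 \<in> V \<Longrightarrow> E (- t) = E t"
  shows "(\<lambda>v. E (csqrt v)) holomorphic_on V"
proof (rule no_isolated_singularity'[where K = "V \<inter> {0}"])
  let ?U = "{t. t\<^sup>2 \<in> V}"
  have U: "open ?U"
    using continuous_open_preimage[OF _ open_UNIV assms(1), of "\<lambda>t. t\<^sup>2"]
    by (simp add: vimage_def continuous_on_power)
  show "((\<lambda>v. E (csqrt v)) \<longlongrightarrow> E (csqrt z)) (at z within V)" if z: "z \<in> V \<inter> {0}" for z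
  proof -
    have "isCont E 0"
      using E U z by (auto simp: continuous_on_eq_continuous_at dest!: holomorphic_on_imp_continuous_on)
    moreover have "(csqrt \<longlongrightarrow> 0) (at 0)"
    proof -
      have "((\<lambda>v::complex. sqrt (cmod v)) \<longlongrightarrow> sqrt (cmod 0)) (at 0)"
        by (intro tendsto_intros)
      then have "((\<lambda>v. cmod (csqrt v)) \<longlongrightarrow> 0) (at 0)"
        by simp
      then show ?thesis by (rule tendsto_norm_zero_cancel)
    qed
    ultimately have "((\<lambda>v. E (csqrt v)) \<longlongrightarrow> E 0) (at 0)"
      by (rule isCont_tendsto_compose)
    then show ?thesis
      using z by (auto intro: tendsto_within_subset)
  qed
  have "(\<lambda>v. E (csqrt v)) holomorphic_on (V - \<real>\<^sub>\<le>\<^sub>0)"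
    by (rule holomorphic_on_compose_gen[OF _ E, of csqrt, unfolded o_def])
       (auto intro!: holomorphic_intros)
  moreover have "(\<lambda>v. E (csqrt v)) holomorphic_on (V - \<real>\<^sub>\<ge>\<^sub>0)"
  proof -
    have "(\<lambda>v. E (\<i> * csqrt (- v))) holomorphic_on (V - \<real>\<^sub>\<ge>\<^sub>0)"
      by (rule holomorphic_on_compose_gen[OF _ E, of "\<lambda>v. \<i> * csqrt (- v)", unfolded o_def])
         (auto intro!: holomorphic_intros simp: power_mult_distrib uminus_nonneg_Reals_iff
            complex_nonpos_Reals_iff complex_nonneg_Reals_iff)
    moreover have "E (\<i> * csqrt (- v)) = E (csqrt v)" if "v \<in> V" for v
    proof -
      have "(\<i> * csqrt (- v))\<^sup>2 = (csqrt v)\<^sup>2"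
        by (simp add: power_mult_distrib)
      then have "\<i> * csqrt (- v) = csqrt v \<or> \<i> * csqrt (- v) = - csqrt v"
        by (simp only: power2_eq_iff)
      then show ?thesis
        using even[of "csqrt v"] that by auto
    qed
    ultimately show ?thesis
      by (rule holomorphic_transform) auto
  qed
  ultimately have "(\<lambda>v. E (csqrt v)) holomorphic_on ((V - \<real>\<^sub>\<le>\<^sub>0) \<union> (V - \<real>\<^sub>\<ge>\<^sub>0))"
    by (rule holomorphic_on_Un) (use assms(1) in \<open>auto intro!: open_Diff\<close>)
  then show "(\<lambda>v. E (csqrt v)) holomorphic_on V - V \<inter> {0}"
    by (rule holomorphic_on_subset) (auto simp: complex_nonpos_Reals_iff complex_nonneg_Reals_iff complex_eq_iff)
qed (use assms(1) in auto)

text \<open>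
  With \<open>t = w - c\<close> and \<open>\<delta> = (z1 - z2) / 2\<close> one has \<open>(w - z1) * (w - z2) = t\<^sup>2 - \<delta>\<^sup>2\<close>, so the oval is
  symmetric under \<open>t \<mapsto> - t\<close>. The even part of \<open>f\<close> about \<open>c\<close>, and its odd part divided by \<open>t\<close>, are
  even functions of \<open>t\<close>, hence holomorphic functions of \<open>t\<^sup>2\<close>.
\<close>
lemma cassini_decomposition:
  assumes f: "f holomorphic_on {w. cmod ((w - z1) * (w - z2)) < \<rho>}"
  obtains g h where "g holomorphic_on ball 0 \<rho>" "h holomorphic_on ball 0 \<rho>"
    and "\<And>w. cmod ((w - z1) * (w - z2)) < \<rho> \<Longrightarrow>
           f w = g ((w - z1) * (w - z2)) + (w - (z1 + z2) / 2) * h ((w - z1) * (w - z2))"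
proof -
  define c \<delta> where "c = (z1 + z2) / 2" and "\<delta> = (z1 - z2) / 2"
  define V where "V = ball (\<delta>\<^sup>2) \<rho>"
  define U where "U = {t. t\<^sup>2 \<in> V}"
  have shift: "((c + t) - z1) * ((c + t) - z2) = t\<^sup>2 - \<delta>\<^sup>2" for t
    by (simp add: c_def \<delta>_def power2_eq_square field_simps)
  have U: "open U"
    unfolding U_def V_def
    using continuous_open_preimage[OF _ open_UNIV open_ball, of "\<lambda>t. t\<^sup>2" "\<delta>\<^sup>2" \<rho>]
    by (simp add: vimage_def continuous_on_power)
  have mem: "t \<in> U \<longleftrightarrow> cmod (t\<^sup>2 - \<delta>\<^sup>2) < \<rho>" for t
    by (simp add: U_def V_def dist_norm norm_minus_commute)
  have plus: "(\<lambda>t. f (c + t)) holomorphic_on U"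
    by (rule holomorphic_on_compose_gen[OF _ f, of "\<lambda>t. c + t", unfolded o_def])
       (auto intro!: holomorphic_intros simp: mem shift)
  have minus: "(\<lambda>t. f (c - t)) holomorphic_on U"
    by (rule holomorphic_on_compose_gen[OF _ f, of "\<lambda>t. c - t", unfolded o_def])
       (use shift[of "- t" for t] in \<open>auto intro!: holomorphic_intros simp: mem\<close>)
  define E where "E t = (f (c + t) + f (c - t)) / 2" for t
  define D where "D t = (f (c + t) - f (c - t)) / 2" for t
  \<comment> \<open>The odd part vanishes at \<open>0\<close>, so its divided difference there is the quotient by \<open>t\<close>.\<close>
  define H where "H = divdiff D 0"
  have E: "E holomorphic_on U" and D: "D holomorphic_on U"
    unfolding E_def D_def by (intro holomorphic_intros plus minus; simp)+
  have H: "H holomorphic_on U"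
    unfolding H_def by (rule holomorphic_divdiff[OF D U])
  have evE: "E (- t) = E t" for t
    by (simp add: E_def)
  have evH: "H (- t) = H t" for t
    by (simp add: H_def divdiff_def D_def divide_simps)
  have split: "f (c + t) = E t + t * H t" for t
    using divdiff_expand[of D t 0] by (simp add: E_def D_def H_def field_simps)
  define g h where "g u = E (csqrt (u + \<delta>\<^sup>2))" and "h u = H (csqrt (u + \<delta>\<^sup>2))" for u
  have *: "(\<lambda>u. F (csqrt (u + \<delta>\<^sup>2))) holomorphic_on ball 0 \<rho>"
    if "F holomorphic_on U" "\<And>t. F (- t) = F t" for F
  proof -
    have "(\<lambda>v. F (csqrt v)) holomorphic_on V"
      using that by (intro holomorphic_on_even_csqrt) (auto simp: U_def V_def)
    then show ?thesis
      by (rule holomorphic_on_compose_gen[of "\<lambda>u. u + \<delta>\<^sup>2", unfolded o_def, rotated])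
         (auto intro!: holomorphic_intros simp: V_def dist_norm)
  qed
  have sq: "F (csqrt (t\<^sup>2)) = F t" if "\<And>t. F (- t) = F t" for F :: "complex \<Rightarrow> complex" and t
  proof -
    have "csqrt (t\<^sup>2) = t \<or> csqrt (t\<^sup>2) = - t"
      by (simp add: power2_eq_iff[symmetric])
    then show ?thesis using that by auto
  qed
  show thesis
  proof
    show "g holomorphic_on ball 0 \<rho>" "h holomorphic_on ball 0 \<rho>"
      unfolding g_def h_def using * E H evE evH by blast+
    show "f w = g ((w - z1) * (w - z2)) + (w - (z1 + z2) / 2) * h ((w - z1) * (w - z2))" for w
    proof -
      have "(w - z1) * (w - z2) = (w - c)\<^sup>2 - \<delta>\<^sup>2"
        using shift[of "w - c"] by simp
      then show ?thesis
        using split[of "w - c"] sq[of E, OF evE] sq[of H, OF evH]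
        by (simp add: g_def h_def c_def[symmetric])
    qed
  qed
qed

section \<open>Taylor coefficients as iterated divided differences\<close>

lemma continuous_on_eq_off_finite:
  fixes F G :: "complex \<Rightarrow> complex"
  assumes "continuous_on U F" "continuous_on U G" "open U" "finite X"
    and eq: "\<And>w. w \<in> U - X \<Longrightarrow> F w = G w" and "w \<in> U"
  shows "F w = G w"
proof -
  have F: "F \<midarrow>w\<rightarrow> F w" and G: "G \<midarrow>w\<rightarrow> G w"
    using assms by (auto simp: continuous_on_eq_continuous_at isCont_def)
  have "open (U - (X - {w}))"
    using assms by (intro open_Diff finite_imp_closed) auto
  then have "\<forall>\<^sub>F x in at w. x \<in> U - (X - {w})"
    using assms by (intro eventually_at_in_open') auto
  moreover have "\<forall>\<^sub>F x in at w. x \<noteq> w"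
    by (simp add: eventually_at_filter)
  ultimately have "\<forall>\<^sub>F x in at w. F x = G x"
    by eventually_elim (use eq in auto)
  with F have "G \<midarrow>w\<rightarrow> F w"
    by (rule Lim_transform_eventually)
  then show ?thesis
    using G by (metis LIM_unique)
qed

text \<open>
  The divided difference at \<open>0\<close> drops the constant term of a power series and shifts the others.
  At \<open>u = 0\<close> itself this holds because both sides are continuous there.
\<close>
lemma power_series_coeff_divdiff:
  assumes "0 < \<rho>" and "g holomorphic_on ball 0 \<rho>"
    and "\<And>u. u \<in> ball 0 \<rho> \<Longrightarrow> (\<lambda>k. b k * u ^ k) sums g u"
  shows "b n = ((\<lambda>g. divdiff g 0) ^^ n) g 0"
  using assms(2,3)
proof (induction n arbitrary: g b)
  case 0
  have "g 0 = b 0"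
    using 0(2)[of 0] assms(1) powser_sums_zero[of b] by (auto intro: sums_unique2)
  then show ?case by simp
next
  case (Suc n)
  have hol: "divdiff g 0 holomorphic_on ball 0 \<rho>"
    by (rule holomorphic_divdiff) (use Suc.prems in auto)
  have g0: "g 0 = b 0"
    using Suc.prems(2)[of 0] assms(1) powser_sums_zero[of b] by (auto intro: sums_unique2)
  have off: "(\<lambda>k. b (Suc k) * u ^ k) sums divdiff g 0 u" if "u \<noteq> 0" "norm u < \<rho>" for u
  proof -
    have "(\<lambda>k. b (Suc k) * u ^ Suc k) sums (g u - b 0)"
      using Suc.prems(2)[of u] that by (subst sums_Suc_iff) simp
    from sums_divide[OF this, of u] show ?thesis
      using that by (simp add: divdiff_def g0)
  qed
  have "divdiff g 0 \<midarrow>0\<rightarrow> b (Suc 0)"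
    using powser_limit_0_strong[OF assms(1) off] by simp
  moreover have "divdiff g 0 \<midarrow>0\<rightarrow> divdiff g 0 0"
    using holomorphic_on_imp_continuous_on[OF hol] assms(1)
    by (auto simp: continuous_on_eq_continuous_at isCont_def)
  ultimately have at0: "divdiff g 0 0 = b (Suc 0)"
    by (metis LIM_unique)
  have "(\<lambda>k. b (Suc k) * u ^ k) sums divdiff g 0 u" if "u \<in> ball 0 \<rho>" for u
  proof (cases "u = 0")
    case True
    then show ?thesis
      using powser_sums_zero[of "\<lambda>k. b (Suc k)"] by (simp add: at0)
  qed (use off that in auto)
  from Suc.IH[OF hol this] show ?case
    by (simp add: funpow_Suc_right del: funpow.simps)
qed

lemma divdiff_funpow_sums:
  assumes g: "g holomorphic_on ball 0 \<rho>" and u: "u \<in> ball 0 \<rho>"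
  shows "(\<lambda>n. ((\<lambda>g. divdiff g 0) ^^ n) g 0 * u ^ n) sums g u"
proof -
  have "0 < \<rho>" using u by (metis mem_ball_0 norm_ge_zero order_le_less_trans)
  have sums: "(\<lambda>n. (deriv ^^ n) g 0 / fact n * u ^ n) sums g u" if "u \<in> ball 0 \<rho>" for u
    using holomorphic_power_series[OF g that] by simp
  have "(deriv ^^ n) g 0 / fact n = ((\<lambda>g. divdiff g 0) ^^ n) g 0" for n
    by (rule power_series_coeff_divdiff[OF \<open>0 < \<rho>\<close> g sums])
  with sums[OF u] show ?thesis by simp
qed

text \<open>
  At a node the argument of \<open>g\<close> and \<open>h\<close> vanishes, so the linear interpolant of
  \<open>g (p w) + (w - c) * h (p w)\<close> is \<open>g 0 + (w - c) * h 0\<close>. Subtracting it and dividing by \<open>p w\<close>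
  leaves the divided differences of \<open>g\<close> and \<open>h\<close> at \<open>0\<close>, away from the nodes; continuity extends the
  identity to the nodes, where the coefficients are read off.
\<close>
lemma node_quotient_funpow_decomposition:
  fixes z1 z2 c :: complex
  assumes "z1 \<noteq> z2" and "f holomorphic_on {w. cmod ((w - z1) * (w - z2)) < \<rho>}"
    and "g holomorphic_on ball 0 \<rho>" "h holomorphic_on ball 0 \<rho>"
    and "\<And>w. cmod ((w - z1) * (w - z2)) < \<rho> \<Longrightarrow>
           f w = g ((w - z1) * (w - z2)) + (w - c) * h ((w - z1) * (w - z2))"
    and w: "cmod ((w - z1) * (w - z2)) < \<rho>"
  shows "(node_quotient z1 z2 ^^ n) f w = ((\<lambda>g. divdiff g 0) ^^ n) g ((w - z1) * (w - z2))
           + (w - c) * ((\<lambda>g. divdiff g 0) ^^ n) h ((w - z1) * (w - z2))"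
  using assms(2-5)
proof (induction n arbitrary: f g h)
  case 0
  then show ?case using w by simp
next
  case (Suc n)
  let ?p = "\<lambda>w. (w - z1) * (w - z2)"
  let ?U = "{w. cmod (?p w) < \<rho>}"
  let ?G = "\<lambda>w. divdiff g 0 (?p w) + (w - c) * divdiff h 0 (?p w)"
  have U: "open ?U"
    by (intro open_Collect_less continuous_intros)
  have \<rho>: "0 < \<rho>" using w by (meson norm_ge_zero order_le_less_trans)
  have Q: "node_quotient z1 z2 f holomorphic_on ?U"
    using holomorphic_node_quotient_funpow[OF Suc.prems(1) U, where n = 1] by simp
  have gh: "divdiff g 0 holomorphic_on ball 0 \<rho>" "divdiff h 0 holomorphic_on ball 0 \<rho>"
    using Suc.prems by (auto intro: holomorphic_divdiff)
  have "(\<lambda>w. divdiff g 0 (?p w)) holomorphic_on ?U" "(\<lambda>w. divdiff h 0 (?p w)) holomorphic_on ?U"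
    by (rule holomorphic_on_compose_gen[OF _ gh(1), of ?p, unfolded o_def]
             holomorphic_on_compose_gen[OF _ gh(2), of ?p, unfolded o_def],
        auto intro!: holomorphic_intros)+
  then have G: "?G holomorphic_on ?U"
    by (intro holomorphic_intros)
  have "node_quotient z1 z2 f x = ?G x" if "cmod (?p x) < \<rho>" for x
  proof (rule continuous_on_eq_off_finite[of ?U _ ?G "{z1, z2}"])
    fix x assume x: "x \<in> ?U - {z1, z2}"
    have ends: "f z1 = g 0 + (z1 - c) * h 0" "f z2 = g 0 + (z2 - c) * h 0"
      using Suc.prems(4)[of z1] Suc.prems(4)[of z2] \<rho> by simp_all
    have lin: "f z2 / (z2 - z1) * (x - z1) + f z1 / (z1 - z2) * (x - z2) = g 0 + (x - c) * h 0"
      unfolding ends using assms(1) by (simp add: divide_simps) (simp add: algebra_simps)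
    have "?p x * node_quotient z1 z2 f x = f x - (g 0 + (x - c) * h 0)"
      using node_quotient_expand[OF assms(1), of f x] unfolding lin by (simp add: algebra_simps)
    also have "\<dots> = (g (?p x) - g 0) + (x - c) * (h (?p x) - h 0)"
      using Suc.prems(4)[of x] x by (simp add: algebra_simps)
    also have "g (?p x) - g 0 = ?p x * divdiff g 0 (?p x)"
      using divdiff_expand[of g "?p x" 0] by simp
    also have "h (?p x) - h 0 = ?p x * divdiff h 0 (?p x)"
      using divdiff_expand[of h "?p x" 0] by simp
    also have "?p x * divdiff g 0 (?p x) + (x - c) * (?p x * divdiff h 0 (?p x)) = ?p x * ?G x"
      by (simp only: distrib_left mult.left_commute)
    finally show "node_quotient z1 z2 f x = ?G x"
      using x by simp
  qed (use that U Q G in \<open>auto intro: holomorphic_on_imp_continuous_on\<close>)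
  from Suc.IH[OF Q gh this] show ?case
    by (simp add: funpow_Suc_right del: funpow.simps)
qed

text \<open>
  By \<open>node_quotient_funpow_decomposition\<close> at the nodes, the \<open>n\<close>-th linear factor takes the
  values \<open>a n + (s - c) * b n\<close> at the nodes \<open>s\<close>, where \<open>a\<close> and \<open>b\<close> are the Taylor coefficients of
  \<open>g\<close> and \<open>h\<close>. It is thus \<open>a n + (z - c) * b n\<close>, and the series splits into two Taylor series.
\<close>
lemma two_point_taylor_sums:
  assumes "z1 \<noteq> z2" and f: "f holomorphic_on {w. cmod ((w - z1) * (w - z2)) < \<rho>}"
    and z: "cmod ((z - z1) * (z - z2)) < \<rho>"
  shows "(\<lambda>n. ((node_quotient z1 z2 ^^ n) f z2 / (z2 - z1) * (z - z1)
              + (node_quotient z1 z2 ^^ n) f z1 / (z1 - z2) * (z - z2))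
            * (z - z1) ^ n * (z - z2) ^ n) sums f z"
proof -
  define u where "u = (z - z1) * (z - z2)"
  define c where "c = (z1 + z2) / 2"
  obtain g h where g: "g holomorphic_on ball 0 \<rho>" and h: "h holomorphic_on ball 0 \<rho>"
    and fgh: "\<And>w. cmod ((w - z1) * (w - z2)) < \<rho> \<Longrightarrow>
           f w = g ((w - z1) * (w - z2)) + (w - c) * h ((w - z1) * (w - z2))"
    using cassini_decomposition[OF f] unfolding c_def by metis
  have \<rho>: "0 < \<rho>" using z by (meson norm_ge_zero order_le_less_trans)
  define a b where "a n = ((\<lambda>g. divdiff g 0) ^^ n) g 0"
    and "b n = ((\<lambda>g. divdiff g 0) ^^ n) h 0" for n
  have node: "(node_quotient z1 z2 ^^ n) f s = a n + (s - c) * b n" if "s \<in> {z1, z2}" for n s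
    using node_quotient_funpow_decomposition[OF assms(1) f g h fgh, of s n] that \<rho>
    by (auto simp: a_def b_def)
  have "(\<lambda>n. a n * u ^ n + (z - c) * (b n * u ^ n)) sums (g u + (z - c) * h u)"
    unfolding a_def b_def
    by (intro sums_add sums_mult divdiff_funpow_sums[OF g] divdiff_funpow_sums[OF h])
       (use z in \<open>auto simp: u_def\<close>)
  moreover have "g u + (z - c) * h u = f z"
    using fgh[OF z] by (simp add: u_def)
  moreover have "((node_quotient z1 z2 ^^ n) f z2 / (z2 - z1) * (z - z1)
              + (node_quotient z1 z2 ^^ n) f z1 / (z1 - z2) * (z - z2))
            * (z - z1) ^ n * (z - z2) ^ n = a n * u ^ n + (z - c) * (b n * u ^ n)" for n
  proof -
    have "(a n + (z2 - c) * b n) / (z2 - z1) * (z - z1) + (a n + (z1 - c) * b n) / (z1 - z2) * (z - z2)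
        = a n + (z - c) * b n"
      using assms(1) by (simp add: divide_simps) (simp add: algebra_simps)
    then have "((node_quotient z1 z2 ^^ n) f z2 / (z2 - z1) * (z - z1)
              + (node_quotient z1 z2 ^^ n) f z1 / (z1 - z2) * (z - z2)) = a n + (z - c) * b n"
      by (simp add: node)
    then show ?thesis
      by (simp only: u_def power_mult_distrib distrib_right mult.assoc)
  qed
  ultimately show ?thesis by simp
qed

section \<open>The two-point Taylor expansion\<close>

theorem theorem1:
  fixes f :: "complex \<Rightarrow> complex" and \<Omega> :: "complex set" and z1 z2 :: complex
  assumes "open \<Omega>" and "f analytic_on \<Omega>"
    and "z1 \<in> \<Omega>" and "z2 \<in> \<Omega>" and "z1 \<noteq> z2"
  shows "\<exists>(a :: nat \<Rightarrow> complex \<Rightarrow> complex \<Rightarrow> complex)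
          (r :: nat \<Rightarrow> complex \<Rightarrow> complex \<Rightarrow> complex \<Rightarrow> complex).
     (\<forall>N\<ge>1. \<forall>z\<in>\<Omega>.
        f z = (\<Sum>n<N. (a n z1 z2 * (z - z1) + a n z2 z1 * (z - z2)) * (z - z1) ^ n * (z - z2) ^ n)
              + r N z1 z2 z) \<and>
     (\<forall>C. ccw_loop_around \<Omega> {z1, z2} C \<longrightarrow>
        (\<forall>n. a n z1 z2 = tp_coeff f C n z1 z2 \<and> a n z2 z1 = tp_coeff f C n z2 z1)) \<and>
     (\<forall>N\<ge>1. \<forall>z C. ccw_loop_around \<Omega> {z, z1, z2} C \<longrightarrow>
        r N z1 z2 z = tp_remainder f C N z1 z2 z) \<and>
     (\<forall>z\<in>cassini_oval \<Omega> z1 z2. (\<lambda>N. r N z1 z2 z) \<longlonglongrightarrow> 0) \<and>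
     (\<Omega> = UNIV \<longrightarrow> (\<forall>z. (\<lambda>N. r N z1 z2 z) \<longlonglongrightarrow> 0))"
proof -
  \<comment> \<open>The quotient is formed with the nodes in a fixed order, so that \<open>A n z1 z2\<close> and
    \<open>A n z2 z1\<close> use values of one and the same iterated quotient.\<close>
  define A where "A n x y = (node_quotient z1 z2 ^^ n) f y / (y - x)" for n x y
  define R where "R N x y z =
    f z - (\<Sum>n<N. (A n x y * (z - x) + A n y x * (z - y)) * (z - x) ^ n * (z - y) ^ n)" for N x y z
  have hol: "f holomorphic_on \<Omega>"
    using assms(2) by (rule analytic_imp_holomorphic)
  have R: "R N z1 z2 z = (z - z1) ^ N * (z - z2) ^ N * (node_quotient z1 z2 ^^ N) f z" for N z
    using node_quotient_funpow_expand[OF assms(5), of f z N] by (simp add: R_def A_def)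
  have coeffs: "A n z1 z2 = tp_coeff f C n z1 z2 \<and> A n z2 z1 = tp_coeff f C n z2 z1"
    if C: "ccw_loop_around \<Omega> {z1, z2} C" for C n
  proof -
    note int = has_contour_integral_node_quotient_funpow[OF assms(1) hol assms(5) C,
        THEN contour_integral_unique, of _ n]
    have "contour_integral C (\<lambda>w. f w / ((w - z1) ^ n * (w - z2) ^ (n + 1)))
            = 2 * of_real pi * \<i> * (node_quotient z1 z2 ^^ n) f z2"
      using int[of z2] by (simp add: power_mult_distrib mult_ac)
    moreover have "contour_integral C (\<lambda>w. f w / ((w - z2) ^ n * (w - z1) ^ (n + 1)))
            = 2 * of_real pi * \<i> * (node_quotient z1 z2 ^^ n) f z1"
      using int[of z1] by (simp add: power_mult_distrib mult_ac)
    ultimately show ?thesis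
      by (simp add: A_def tp_coeff_def)
  qed
  have remainder: "R N z1 z2 z = tp_remainder f C N z1 z2 z"
    if C: "ccw_loop_around \<Omega> {z, z1, z2} C" for C N z
    using has_contour_integral_node_quotient_funpow[OF assms(1) hol assms(5) C,
        THEN contour_integral_unique, of z N]
    by (simp add: R tp_remainder_def power_mult_distrib mult_ac)
  have conv: "(\<lambda>N. R N z1 z2 z) \<longlonglongrightarrow> 0" if z: "z \<in> cassini_oval \<Omega> z1 z2" for z
  proof -
    from z have "ereal (cmod ((z - z1) * (z - z2))) < cassini_radius \<Omega> z1 z2"
      by (simp add: cassini_oval_def)
    \<comment> \<open>A real radius strictly in between also covers the case of an infinite Cassini radius.\<close>
    then obtain \<rho> where \<rho>: "cmod ((z - z1) * (z - z2)) < \<rho>" "ereal \<rho> < cassini_radius \<Omega> z1 z2"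
      using ereal_dense2 by (metis less_ereal.simps(1))
    have "w \<in> \<Omega>" if "cmod ((w - z1) * (w - z2)) < \<rho>" for w
    proof (rule ccontr)
      assume "w \<notin> \<Omega>"
      then have "cassini_radius \<Omega> z1 z2 \<le> ereal (cmod ((w - z1) * (w - z2)))"
        unfolding cassini_radius_def by (intro INF_lower) auto
      also have "\<dots> < ereal \<rho>" using that by simp
      finally show False using \<rho>(2) by simp
    qed
    then have "f holomorphic_on {w. cmod ((w - z1) * (w - z2)) < \<rho>}"
      by (intro holomorphic_on_subset[OF hol]) auto
    from two_point_taylor_sums[OF assms(5) this \<rho>(1)]
    have "(\<lambda>N. \<Sum>n<N. (A n z1 z2 * (z - z1) + A n z2 z1 * (z - z2)) * (z - z1) ^ n * (z - z2) ^ n)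
            \<longlonglongrightarrow> f z"
      unfolding sums_def A_def .
    from tendsto_diff[OF tendsto_const[of "f z"] this] show ?thesis
      by (simp add: R_def)
  qed
  have "cassini_oval \<Omega> z1 z2 = UNIV" if "\<Omega> = UNIV"
    using that by (simp add: cassini_oval_def cassini_radius_def top_ereal_def)
  then show ?thesis
    by (intro exI[of _ A] exI[of _ R]) (use coeffs remainder conv in \<open>auto simp: R_def\<close>)
qed

end
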